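(* Let $l\ge1$ and let the discrete space be either $V_h^l$ or $W_h^l$. Assume that the discontinuous Galerkin solution of the nonlinear Vlasov–Poisson system satisfies $f_h(x,\pm V_c,t)=0$. Then $$\sum_{i,j}\mathcal{H}^{nonlin}_{i,j}(f_h,E_h,v)=0,$$ which implies that the fully discrete scheme (third order TVD Runge–Kutta in time) satisfies $$\sum_{i,j}\int_{I_{i,j}}f_h^{n+1}\,v\,dx\,dv=\sum_{i,j}\int_{I_{i,j}}f_h^{n}\,v\,dx\,dv.$$
   Context: Equation: the one-dimensional Vlasov–Poisson system $\partial_tf+v f_x-Ef_v=0$, $-\Phi_{xx}=1-\int f\,dv$, $E=-\Phi_x$, periodic in $x\in[0,L]$, with velocity domain truncated to $[-V_c,V_c]$. Mesh: $0=x_{1/2}<x_{3/2}<\dots<x_{N_x+1/2}=L$, $-V_c=v_{1/2}<\dots<v_{N_v+1/2}=V_c$; $J_i=[x_{i-1/2},x_{i+1/2}]$, $K_j=[v_{j-1/2},v_{j+1/2}]$, $I_{i,j}=J_i\times K_j$, $1\le i\le N_x$, $1\le j\le N_v$. The mesh is chosen such that $v$ has a single sign in each $K_j$. All functions of $x$ are extended periodically (traces at $x_{1/2}$ and $x_{N_x+1/2}$ are identified accordingly). Spaces: $V_h^l$ is the set of functions whose restriction to each $I_{i,j}$ lies in $\mathbb{Q}^l=\mathrm{span}\{x^{l_1}v^{l_2}:0\le l_1,l_2\le l\}$; $W_h^l$ is the same with $\mathbb{P}^l=\mathrm{span}\{x^{l_1}v^{l_2}:l_1,l_2\ge0,\ l_1+l_2\le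 l\}$. Notation: $(\varphi)^\pm_{i+1/2,v}=\lim_{\epsilon\to0^+}\varphi(x_{i+1/2}\pm\epsilon,v)$, $(\varphi)^\pm_{x,j+1/2}=\lim_{\epsilon\to0^+}\varphi(x,v_{j+1/2}\pm\epsilon)$. Upwind fluxes: $\widehat{vf_h}=vf_h^-$ if $v\ge0$ in $K_j$, $\widehat{vf_h}=vf_h^+$ if $v<0$ in $K_j$; $\widehat{E_hf_h}=E_hf_h^-$ if $\int_{J_i}E_h\,dx\le0$, $\widehat{E_hf_h}=E_hf_h^+$ if $\int_{J_i}E_h\,dx>0$. The assumption $f_h(x,\pm V_c,t)=0$ means that both traces of $f_h$ at $v=\pm V_c$ (interior and exterior) vanish, so the fluxes $\widehat{E_hf_h}$ there are zero; for the fully discrete scheme it is assumed for $f_h^n,f_h^{(1)},f_h^{(2)}$. Operator: $$\mathcal{H}^{nonlin}_{i,j}(f_h,E_h,\varphi_h)=\int_{I_{i,j}}vf_h(\varphi_h)_x\,dx\,dv-\int_{K_j}(\widehat{vf_h}\varphi_h^-)_{i+\frac12,v}\,dv+\int_{K_j}(\widehat{vf_h}\varphi_h^+)_{i-\frac12,v}\,dv-\int_{I_{i,j}}E_hf_h(\varphi_h)_v\,dx\,dv+\int_{J_i}(\widehat{E_hf_h}\varphi_h^-)_{x,j+\frac12}\,dx-\int_{J_i}(\widehat{E_hf_h}\varphi_h^+)_{x,j-\frac12}\,dx.$$ The semi-discrete scheme seeks $f_h$ in the discrete space with $\int_{I_{i,j}}(f_h)_t\varphi_h\,dx\,dv=\mathcal{H}^{nonlin}_{i,j}(f_h,E_h,\varphi_h)$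 for all test functions $\varphi_h$ in the discrete space and all $i,j$. Electric field (exact Poisson solver): with $\rho_h(x,t)=\int_{-V_c}^{V_c}f_h\,dv$, $\Phi_h=\int_0^x\int_0^s\rho_h(z,t)\,dz\,ds-\frac{x^2}{2}-C_Ex$, $C_E=-\frac L2+\frac1L\int_0^L\int_0^s\rho_h(z,t)\,dz\,ds$, $E_h=-(\Phi_h)_x=C_E+x-\int_0^x\rho_h(z,t)\,dz$; thus $\Phi_h(0)=\Phi_h(L)=0$. $E_h^n,E_h^{(1)},E_h^{(2)}$ are obtained in this way from $f_h^n,f_h^{(1)},f_h^{(2)}$. Standing assumption (charge neutrality): $\int_0^L\rho_h\,dx=L$ at the initial time. Under the velocity boundary condition the scheme conserves total charge, so this holds at all times and stages and $E_h(0)=E_h(L)$. Fully discrete scheme from $t^n$ to $t^{n+1}$ with time step $\Delta t$: for all test functions $\varphi_h$ and all $i,j$, with $\mathcal{H}=\mathcal{H}^{nonlin}$ and integrals over $I_{i,j}$, $\int f_h^{(1)}\varphi_h=\int f_h^n\varphi_h+\Delta t\,\mathcal{H}_{i,j}(f_h^n,E_h^n,\varphi_h)$; $\int f_h^{(2)}\varphi_h=\frac34\int f_h^n\varphi_h+\frac14\int f_h^{(1)}\varphi_h+\frac{\Delta t}{4}\mathcal{H}_{i,j}(f_h^{(1)},E_h^{(1)},\varphi_h)$; $\int f_h^{n+1}\varphi_h=\frac13\int f_h^n\varphi_h+\frac23\int f_h^{(2)}\varphi_h+\frac{2\Delta t}{3}\mathcal{H}_{i,j}(f_h^{(2)},E_h^{(2)},\varphi_h)$.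 No positivity-preserving limiter is used. *)

theory Defs
  imports "HOL-Analysis.Analysis"
begin

text \<open>Node indices are shifted: \<open>xh M i\<close> and \<open>vh M j\<close> are the mesh points usually written
  $x_{i+1/2}$ and $v_{j+1/2}$, so cell number \<open>i\<close> lies between \<open>xh M (i - 1)\<close> and \<open>xh M i\<close>.\<close>

record mesh =
  plen :: real   (* the period L *)
  vcut :: real   (* the velocity cut-off V_c *)
  nx :: nat
  nv :: nat
  xh :: "nat \<Rightarrow> real"
  vh :: "nat \<Rightarrow> real"

definition cellx :: "mesh \<Rightarrow> nat \<Rightarrow> real set" where
  "cellx M i = {xh M (i - 1)..xh M i}"

definition cellv :: "mesh \<Rightarrow> nat \<Rightarrow> real set" where
  "cellv M j = {vh M (j - 1)..vh M j}"

definition cell :: "mesh \<Rightarrow> nat \<Rightarrow> nat \<Rightarrow> (real \<times> real) set" where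
  "cell M i j = cellx M i \<times> cellv M j"

definition valid_mesh :: "mesh \<Rightarrow> bool" where
  "valid_mesh M \<longleftrightarrow>
     1 \<le> nx M \<and> 1 \<le> nv M \<and>
     xh M 0 = 0 \<and> xh M (nx M) = plen M \<and> (\<forall>i\<in>{1..nx M}. xh M (i - 1) < xh M i) \<and>
     vh M 0 = - vcut M \<and> vh M (nv M) = vcut M \<and> (\<forall>j\<in>{1..nv M}. vh M (j - 1) < vh M j) \<and>
     (\<forall>j\<in>{1..nv M}. (\<forall>v\<in>cellv M j. 0 \<le> v) \<or> (\<forall>v\<in>cellv M j. v \<le> 0))"

definition Qpoly :: "nat \<Rightarrow> (real \<Rightarrow> real \<Rightarrow> real) set" where
  "Qpoly l = {p. \<exists>c :: nat \<Rightarrow> nat \<Rightarrow> real. \<forall>x v. p x v = (\<Sum>a\<le>l. \<Sum>b\<le>l. c a b * x ^ a * v ^ b)}"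

definition Ppoly :: "nat \<Rightarrow> (real \<Rightarrow> real \<Rightarrow> real) set" where
  "Ppoly l = {p. \<exists>c :: nat \<Rightarrow> nat \<Rightarrow> real. \<forall>x v. p x v = (\<Sum>a\<le>l. \<Sum>b\<le>l - a. c a b * x ^ a * v ^ b)}"

text \<open>Members of the discrete spaces are functions on the whole plane, periodic in \<open>x\<close>. They are
  piecewise polynomial on the open cells only: on cell interfaces they are double valued, so the
  value of the function there is irrelevant and never enters the scheme, which uses one-sided
  limits. Values for \<open>v\<close> outside the velocity domain are unconstrained; they only serve to
  give a meaning to exterior traces at the two velocity boundaries.\<close>

definition piecewise_space ::
    "mesh \<Rightarrow> (real \<Rightarrow> real \<Rightarrow> real) set \<Rightarrow> (real \<Rightarrow> real \<Rightarrow> real) set" where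
  "piecewise_space M P = {f.
     (\<forall>x v. f (x + plen M) v = f x v) \<and>
     (\<forall>i\<in>{1..nx M}. \<forall>j\<in>{1..nv M}. \<exists>p\<in>P.
        \<forall>x\<in>interior (cellx M i). \<forall>v\<in>interior (cellv M j). f x v = p x v)}"

definition Vh :: "mesh \<Rightarrow> nat \<Rightarrow> (real \<Rightarrow> real \<Rightarrow> real) set" where
  "Vh M l = piecewise_space M (Qpoly l)"

definition Wh :: "mesh \<Rightarrow> nat \<Rightarrow> (real \<Rightarrow> real \<Rightarrow> real) set" where
  "Wh M l = piecewise_space M (Ppoly l)"

definition xtrace_minus :: "(real \<Rightarrow> real \<Rightarrow> real) \<Rightarrow> real \<Rightarrow> real \<Rightarrow> real" where
  "xtrace_minus \<phi> x v = Lim (at_left x) (\<lambda>y. \<phi> y v)"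

definition xtrace_plus :: "(real \<Rightarrow> real \<Rightarrow> real) \<Rightarrow> real \<Rightarrow> real \<Rightarrow> real" where
  "xtrace_plus \<phi> x v = Lim (at_right x) (\<lambda>y. \<phi> y v)"

definition vtrace_minus :: "(real \<Rightarrow> real \<Rightarrow> real) \<Rightarrow> real \<Rightarrow> real \<Rightarrow> real" where
  "vtrace_minus \<phi> x v = Lim (at_left v) (\<lambda>w. \<phi> x w)"

definition vtrace_plus :: "(real \<Rightarrow> real \<Rightarrow> real) \<Rightarrow> real \<Rightarrow> real \<Rightarrow> real" where
  "vtrace_plus \<phi> x v = Lim (at_right v) (\<lambda>w. \<phi> x w)"

definition vflux :: "mesh \<Rightarrow> nat \<Rightarrow> (real \<Rightarrow> real \<Rightarrow> real) \<Rightarrow> real \<Rightarrow> real \<Rightarrow> real" where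
  "vflux M j f x v =
     (if \<forall>w\<in>cellv M j. 0 \<le> w then v * xtrace_minus f x v else v * xtrace_plus f x v)"

definition Eflux ::
    "mesh \<Rightarrow> nat \<Rightarrow> (real \<Rightarrow> real \<Rightarrow> real) \<Rightarrow> (real \<Rightarrow> real) \<Rightarrow> real \<Rightarrow> real \<Rightarrow> real" where
  "Eflux M i f E x v =
     (if integral (cellx M i) E \<le> 0 then E x * vtrace_minus f x v else E x * vtrace_plus f x v)"

definition Hnonlin ::
    "mesh \<Rightarrow> nat \<Rightarrow> nat \<Rightarrow> (real \<Rightarrow> real \<Rightarrow> real) \<Rightarrow> (real \<Rightarrow> real) \<Rightarrow> (real \<Rightarrow> real \<Rightarrow> real) \<Rightarrow> real" where
  "Hnonlin M i j f E \<phi> =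
     integral (cell M i j) (\<lambda>(x, v). v * f x v * deriv (\<lambda>y. \<phi> y v) x)
     - integral (cellv M j) (\<lambda>v. vflux M j f (xh M i) v * xtrace_minus \<phi> (xh M i) v)
     + integral (cellv M j) (\<lambda>v. vflux M j f (xh M (i - 1)) v * xtrace_plus \<phi> (xh M (i - 1)) v)
     - integral (cell M i j) (\<lambda>(x, v). E x * f x v * deriv (\<lambda>w. \<phi> x w) v)
     + integral (cellx M i) (\<lambda>x. Eflux M i f E x (vh M j) * vtrace_minus \<phi> x (vh M j))
     - integral (cellx M i) (\<lambda>x. Eflux M i f E x (vh M (j - 1)) * vtrace_plus \<phi> x (vh M (j - 1)))"

definition charge_density :: "mesh \<Rightarrow> (real \<Rightarrow> real \<Rightarrow> real) \<Rightarrow> real \<Rightarrow> real" where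
  "charge_density M f x = integral {- vcut M..vcut M} (\<lambda>v. f x v)"

definition charge_neutral :: "mesh \<Rightarrow> (real \<Rightarrow> real \<Rightarrow> real) \<Rightarrow> bool" where
  "charge_neutral M f \<longleftrightarrow> integral {0..plen M} (charge_density M f) = plen M"

definition efield_const :: "mesh \<Rightarrow> (real \<Rightarrow> real \<Rightarrow> real) \<Rightarrow> real" where
  "efield_const M f =
     - plen M / 2
     + 1 / plen M * integral {0..plen M} (\<lambda>s. integral {0..s} (charge_density M f))"

text \<open>With \<open>\<Phi>(x) = \<integral>\<^sub>0\<^sup>x \<integral>\<^sub>0\<^sup>s \<rho>(z) dz ds - x\<^sup>2/2 - C x\<close>, where \<open>C\<close> is \<open>efield_const\<close>, this is
  \<open>- \<Phi>'\<close>; the constant is the one that makes \<open>\<Phi>(L) = 0\<close>. Only values for \<open>x\<close> in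
  \<open>[0, L]\<close> are used.\<close>

definition efield :: "mesh \<Rightarrow> (real \<Rightarrow> real \<Rightarrow> real) \<Rightarrow> real \<Rightarrow> real" where
  "efield M f x = efield_const M f + x - integral {0..x} (charge_density M f)"

definition zero_at_cutoff :: "mesh \<Rightarrow> (real \<Rightarrow> real \<Rightarrow> real) \<Rightarrow> bool" where
  "zero_at_cutoff M f \<longleftrightarrow>
     (\<forall>i\<in>{1..nx M}. \<forall>x\<in>interior (cellx M i). \<forall>w\<in>{- vcut M, vcut M}.
        ((\<lambda>v. f x v) \<longlongrightarrow> 0) (at_left w) \<and> ((\<lambda>v. f x v) \<longlongrightarrow> 0) (at_right w))"

definition cell_inner ::
    "mesh \<Rightarrow> nat \<Rightarrow> nat \<Rightarrow> (real \<Rightarrow> real \<Rightarrow> real) \<Rightarrow> (real \<Rightarrow> real \<Rightarrow> real) \<Rightarrow> real" where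
  "cell_inner M i j f \<phi> = integral (cell M i j) (\<lambda>(x, v). f x v * \<phi> x v)"

definition semidiscrete_solution ::
    "mesh \<Rightarrow> (real \<Rightarrow> real \<Rightarrow> real) set \<Rightarrow> real \<Rightarrow> (real \<Rightarrow> real \<Rightarrow> real \<Rightarrow> real) \<Rightarrow> bool" where
  "semidiscrete_solution M S T f \<longleftrightarrow>
     (\<forall>t\<in>{0..T}. f t \<in> S) \<and>
     (\<forall>t\<in>{0..T}. \<forall>i\<in>{1..nx M}. \<forall>j\<in>{1..nv M}.
        \<forall>x\<in>interior (cellx M i). \<forall>v\<in>interior (cellv M j).
          (\<lambda>s. f s x v) differentiable (at t within {0..T})) \<and>
     (\<forall>t\<in>{0..T}. \<forall>\<phi>\<in>S. \<forall>i\<in>{1..nx M}. \<forall>j\<in>{1..nv M}.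
        cell_inner M i j (\<lambda>x v. vector_derivative (\<lambda>s. f s x v) (at t within {0..T})) \<phi>
          = Hnonlin M i j (f t) (efield M (f t)) \<phi>)"

definition rk3_step ::
    "mesh \<Rightarrow> (real \<Rightarrow> real \<Rightarrow> real) set \<Rightarrow> real \<Rightarrow> (real \<Rightarrow> real \<Rightarrow> real) \<Rightarrow>
     (real \<Rightarrow> real \<Rightarrow> real) \<Rightarrow> (real \<Rightarrow> real \<Rightarrow> real) \<Rightarrow> (real \<Rightarrow> real \<Rightarrow> real) \<Rightarrow> bool" where
  "rk3_step M S dt f f1 f2 g \<longleftrightarrow>
     f \<in> S \<and> f1 \<in> S \<and> f2 \<in> S \<and> g \<in> S \<and>
     (\<forall>\<phi>\<in>S. \<forall>i\<in>{1..nx M}. \<forall>j\<in>{1..nv M}.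
        cell_inner M i j f1 \<phi> =
          cell_inner M i j f \<phi> + dt * Hnonlin M i j f (efield M f) \<phi> \<and>
        cell_inner M i j f2 \<phi> =
          3 / 4 * cell_inner M i j f \<phi> + 1 / 4 * cell_inner M i j f1 \<phi>
          + dt / 4 * Hnonlin M i j f1 (efield M f1) \<phi> \<and>
        cell_inner M i j g \<phi> =
          1 / 3 * cell_inner M i j f \<phi> + 2 / 3 * cell_inner M i j f2 \<phi>
          + 2 * dt / 3 * Hnonlin M i j f2 (efield M f2) \<phi>)"

end

theory Submission
  imports Defs
begin

text \<open>
  Testing the scheme with a function \<open>g v\<close> of velocity alone and summing over all cells leaves
  only the volume term of the acceleration. The transport volume term contains \<open>\<partial>\<^sub>x g = 0\<close>; the
  fluxes through vertical edges cancel between neighbouring cells, and at the two ends by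
  periodicity; those through horizontal edges cancel likewise, and vanish at \<open>v = \<plusminus> V\<close> by the
  cut-off assumption. The cancellation rests on the upwind flux being single valued on each
  edge. This is \<open>sum_Hnonlin_velocity_test\<close>, with result
  \<open>- \<integral>\<integral> E f g' dx dv\<close>.

  For \<open>g = 1\<close> the result is \<open>0\<close>: charge is conserved. For \<open>g = v\<close> it is minus the net force
  \<open>\<integral> E \<rho> dx\<close>. Since \<open>\<rho> = 1 - E'\<close>, the force equals \<open>\<integral> E dx - (E(L)\<^sup>2 - E(0)\<^sup>2) / 2\<close>. The first
  term vanishes because the constant in the field makes the potential periodic, and the second
  because \<open>E(L) - E(0) = L - \<integral> \<rho> dx = 0\<close> for a neutral density (\<open>efield_force_zero\<close>).

  Neutrality is assumed at the initial time only, so it has to be propagated. A Runge--Kutta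
  step with zero increments merely averages integrals that are already equal
  (\<open>rk3_step_conserves\<close>), which settles the fully discrete case; the same lemma with test function
  \<open>v\<close> gives the conservation of momentum. In the semi-discrete case one must differentiate the
  total charge in time, although only pointwise differentiability of \<open>f\<close> is given. On a cell,
  Lagrange interpolation writes \<open>f\<close> as a combination of fixed polynomials whose coefficients are
  point values of \<open>f\<close>; hence every cell integral is a finite combination of differentiable
  functions of time (\<open>cell_inner_has_time_derivative\<close>).
\<close>

section \<open>Velocity test functions\<close>

lemma Lim_filtermap: "Lim (filtermap h F) f = Lim F (\<lambda>y. f (h y))"
  unfolding Topological_Spaces.Lim_def filterlim_filtermap ..

lemma Lim_shift_left:
  fixes f :: "real \<Rightarrow> real"
  shows "Lim (at_left (a + c)) f = Lim (at_left a) (\<lambda>y. f (y + c))"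
proof -
  have "(+) c ` {..<a} = {..<c + a}"
    by (force simp: image_iff intro: bexI[of _ "_ - c"])
  then have "filtermap ((+) c) (at_left a) = at_left (c + a)"
    by (subst filtermap_linear_at_within) (auto intro!: continuous_intros open_translation simp: bij_def)
  then show ?thesis
    using Lim_filtermap[of "(+) c" "at_left a" f] by (simp add: add.commute)
qed

lemma Lim_shift_right:
  fixes f :: "real \<Rightarrow> real"
  shows "Lim (at_right (a + c)) f = Lim (at_right a) (\<lambda>y. f (y + c))"
proof -
  have "(+) c ` {a<..} = {c + a<..}"
    by (force simp: image_iff intro: bexI[of _ "_ - c"])
  then have "filtermap ((+) c) (at_right a) = at_right (c + a)"
    by (subst filtermap_linear_at_within) (auto intro!: continuous_intros open_translation simp: bij_def)
  then show ?thesis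
    using Lim_filtermap[of "(+) c" "at_right a" f] by (simp add: add.commute)
qed

text \<open>The vertical edges \<open>x = 0\<close> and \<open>x = L\<close> are one edge of the periodic mesh: translation by the
  period carries the one-sided neighbourhoods of \<open>0\<close> to those of \<open>L\<close>.\<close>

lemma vflux_periodic:
  assumes "\<And>x v. f (x + plen M) v = f x v"
  shows "vflux M j f (plen M) v = vflux M j f 0 v"
  using Lim_shift_left[of 0 "plen M" "\<lambda>y. f y v"] Lim_shift_right[of 0 "plen M" "\<lambda>y. f y v"] assms
  by (simp add: vflux_def xtrace_minus_def xtrace_plus_def)

lemma Eflux_zero_at_cutoff:
  assumes "zero_at_cutoff M f" "i \<in> {1..nx M}" "x \<in> interior (cellx M i)" "w \<in> {- vcut M, vcut M}"
  shows "Eflux M i f E x w = 0"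
proof -
  have "Lim (at_left w) (\<lambda>v. f x v) = 0" "Lim (at_right w) (\<lambda>v. f x v) = 0"
    using assms unfolding zero_at_cutoff_def by (auto intro!: tendsto_Lim)
  then show ?thesis
    by (simp add: Eflux_def vtrace_minus_def vtrace_plus_def)
qed

lemma has_integral_spike_interior_interval:
  fixes f g :: "real \<Rightarrow> real"
  assumes "(g has_integral I) {a..b}" "\<And>x. x \<in> interior {a..b} \<Longrightarrow> f x = g x"
  shows "(f has_integral I) {a..b}"
  by (rule has_integral_spike_finite[of "{a, b}", OF _ _ assms(1)]) (use assms(2) in auto)

text \<open>The boundary of a cell is a null set, so integrals over cells see only the polynomial that
  represents a member of the discrete space in the interior.\<close>

lemma integral_spike_cell:
  fixes f g :: "real \<times> real \<Rightarrow> real"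
  assumes "\<And>x v. x \<in> interior (cellx M i) \<Longrightarrow> v \<in> interior (cellv M j) \<Longrightarrow> f (x, v) = g (x, v)"
  shows "integral (cell M i j) f = integral (cell M i j) g"
proof -
  let ?a = "(xh M (i - 1), vh M (j - 1))" and ?b = "(xh M i, vh M j)"
  have cell: "cell M i j = cbox ?a ?b"
    by (simp add: cell_def cellx_def cellv_def cbox_Pair_eq)
  have "negligible (cbox ?a ?b - box ?a ?b)"
    by (rule negligible_frontier_interval)
  moreover have "g z = f z" if "z \<in> cbox ?a ?b - (cbox ?a ?b - box ?a ?b)" for z
  proof -
    have "z \<in> box ?a ?b" using that by auto
    moreover obtain x v where "z = (x, v)" by fastforce
    ultimately show ?thesis
      using assms[of x v] by (auto simp: box_def Basis_prod_def cellx_def cellv_def)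
  qed
  ultimately show ?thesis
    unfolding cell by (rule integral_spike)
qed

text \<open>Each flux times the continuous function \<open>g\<close> is a function of its edge only, so both families
  of edge integrals telescope.\<close>

theorem sum_Hnonlin_velocity_test:
  assumes mesh: "valid_mesh M"
    and per: "\<And>x v. f (x + plen M) v = f x v"
    and zero: "zero_at_cutoff M f"
    and g: "\<And>v. (g has_real_derivative g' v) (at v)"
  shows "(\<Sum>i=1..nx M. \<Sum>j=1..nv M. Hnonlin M i j f E (\<lambda>x v. g v)) =
    - (\<Sum>i=1..nx M. \<Sum>j=1..nv M. integral (cell M i j) (\<lambda>(x, v). E x * f x v * g' v))"
proof -
  define A where "A i j = integral (cellv M j) (\<lambda>v. vflux M j f (xh M i) v * g v)" for i j
  define B where "B i j = integral (cellx M i) (\<lambda>x. Eflux M i f E x (vh M j) * g (vh M j))" for i j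
  define K where "K i j = integral (cell M i j) (\<lambda>(x, v). E x * f x v * g' v)" for i j
  have lim: "Lim (at_left v) g = g v" "Lim (at_right v) g = g v" for v
    using DERIV_isCont[OF g] by (auto intro!: tendsto_Lim simp: isCont_def filterlim_at_split)
  have lim_const: "Lim (at_left x) (\<lambda>_. c) = c" "Lim (at_right x) (\<lambda>_. c) = c" for x c :: real
    by (auto intro: tendsto_Lim)
  have deriv: "deriv g v = g' v" for v
    by (rule DERIV_imp_deriv[OF g])
  have zero_integral: "integral A (\<lambda>(x, v). 0) = (0 :: real)" for A :: "(real \<times> real) set"
    by (simp add: case_prod_unfold)
  have H: "Hnonlin M i j f E (\<lambda>x v. g v) = - (A i j - A (i - 1) j) - K i j + (B i j - B i (j - 1))" for i j
    unfolding Hnonlin_def A_def B_def K_def xtrace_minus_def xtrace_plus_def vtrace_minus_def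
      vtrace_plus_def
    by (simp add: lim lim_const deriv zero_integral)
  have telescope: "(\<Sum>k=1..n. a k - a (k - 1)) = a n - a 0" for a :: "nat \<Rightarrow> real" and n
    using sum_telescope''[of 0 n a] by simp
  have "A (nx M) j = A 0 j" for j
    using mesh vflux_periodic[of f M, OF per] by (simp add: A_def valid_mesh_def)
  then have "(\<Sum>i=1..nx M. A i j - A (i - 1) j) = 0" for j
    using telescope[of "\<lambda>i. A i j" "nx M"] by simp
  then have A0: "(\<Sum>i=1..nx M. \<Sum>j=1..nv M. A i j - A (i - 1) j) = 0"
    by (subst sum.swap) simp
  \<comment> \<open>The cut-off condition concerns interior abscissae only; the two endpoints of the edge are
    negligible.\<close>
  have "B i j = 0" if i: "i \<in> {1..nx M}" and "j = 0 \<or> j = nv M" for i j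
  proof -
    have "vh M j \<in> {- vcut M, vcut M}"
      using that mesh by (auto simp: valid_mesh_def)
    then show ?thesis
      unfolding B_def cellx_def
      by (intro integral_unique has_integral_spike_interior_interval[OF has_integral_0])
        (use Eflux_zero_at_cutoff[OF zero i] in \<open>auto simp: cellx_def\<close>)
  qed
  then have B0: "(\<Sum>i=1..nx M. \<Sum>j=1..nv M. B i j - B i (j - 1)) = 0"
    by (simp add: telescope[unfolded One_nat_def])
  show ?thesis
    unfolding H K_def[symmetric] sum.distrib sum_subtractf sum_negf
    using A0 B0 by (simp add: sum_subtractf)
qed

section \<open>Cell integrals and the charge density\<close>

lemma has_integral_mesh_sum:
  fixes h :: "real \<Rightarrow> real" and z :: "nat \<Rightarrow> real"
  assumes "\<And>i. i \<in> {1..n} \<Longrightarrow> z (i - 1) \<le> z i"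
    and "\<And>i. i \<in> {1..n} \<Longrightarrow> (h has_integral I i) {z (i - 1)..z i}"
  shows "(h has_integral (\<Sum>i=1..n. I i)) {z 0..z n} \<and> z 0 \<le> z n"
  using assms
proof (induction n)
  case 0
  then show ?case by (simp add: has_integral_refl)
next
  case (Suc n)
  then have IH: "(h has_integral (\<Sum>i=1..n. I i)) {z 0..z n}" "z 0 \<le> z n" by auto
  from Suc.prems(1)[of "Suc n"] Suc.prems(2)[of "Suc n"]
  have *: "z n \<le> z (Suc n)" "(h has_integral I (Suc n)) {z n..z (Suc n)}" by auto
  from has_integral_combine[OF IH(2) *(1) IH(1) *(2)] IH(2) *(1) show ?case by auto
qed

lemma continuous_on_Qpoly:
  assumes "p \<in> Qpoly l"
  shows "continuous_on A (\<lambda>(x, v). p x v)"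
proof -
  obtain c where "\<And>x v. p x v = (\<Sum>a\<le>l. \<Sum>b\<le>l. c a b * x ^ a * v ^ b)"
    using assms unfolding Qpoly_def by blast
  then show ?thesis
    by (auto simp: split_beta intro!: continuous_intros)
qed

lemma Ppoly_subset_Qpoly: "Ppoly l \<subseteq> Qpoly l"
proof
  fix p assume "p \<in> Ppoly l"
  then obtain c where c: "\<And>x v. p x v = (\<Sum>a\<le>l. \<Sum>b\<le>l - a. c a b * x ^ a * v ^ b)"
    unfolding Ppoly_def by blast
  have "p x v = (\<Sum>a\<le>l. \<Sum>b\<le>l. (if b \<le> l - a then c a b else 0) * x ^ a * v ^ b)" for x v
    unfolding c by (intro sum.cong refl sum.mono_neutral_cong_left) auto
  then show "p \<in> Qpoly l"
    unfolding Qpoly_def by (auto intro!: exI[of _ "\<lambda>a b. if b \<le> l - a then c a b else 0"])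
qed

lemma piecewise_space_mono: "P \<subseteq> Q \<Longrightarrow> piecewise_space M P \<subseteq> piecewise_space M Q"
  unfolding piecewise_space_def by fast

lemma Wh_subset_Vh: "Wh M l \<subseteq> Vh M l"
  unfolding Wh_def Vh_def by (intro piecewise_space_mono Ppoly_subset_Qpoly)

lemma Vh_cell_poly:
  assumes "f \<in> Vh M l" "i \<in> {1..nx M}" "j \<in> {1..nv M}"
  obtains p where "p \<in> Qpoly l"
    "\<And>x v. x \<in> interior (cellx M i) \<Longrightarrow> v \<in> interior (cellv M j) \<Longrightarrow> f x v = p x v"
  using assms unfolding Vh_def piecewise_space_def by blast

text \<open>In the strip over a spatial cell, \<open>f x\<close> agrees for each interior \<open>x\<close> with one of finitely many
  polynomials on each velocity cell, up to finitely many velocities. So \<open>\<rho>\<close> is there a sum \<open>R\<close> of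
  integrals of polynomials depending continuously on \<open>x\<close>, and Fubini's theorem for continuous
  functions applies cell by cell. Continuity of \<open>\<rho>\<close> is what makes \<open>E' = 1 - \<rho>\<close> hold
  pointwise away from the nodes.\<close>

lemma
  assumes mesh: "valid_mesh M" and f: "f \<in> Vh M l" and i: "i \<in> {1..nx M}"
  shows continuous_on_charge_density: "continuous_on (interior (cellx M i)) (charge_density M f)"
    and charge_density_strip_integral: "\<And>E. continuous_on (cellx M i) E \<Longrightarrow>
      ((\<lambda>x. E x * charge_density M f x) has_integral
        (\<Sum>j=1..nv M. integral (cell M i j) (\<lambda>(x, v). E x * f x v))) (cellx M i)"
proof -
  have "\<forall>j\<in>{1..nv M}. \<exists>p. p \<in> Qpoly l \<and>
      (\<forall>x\<in>interior (cellx M i). \<forall>v\<in>interior (cellv M j). f x v = p x v)"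
    using Vh_cell_poly[OF f i] by metis
  then obtain p where p: "\<And>j. j \<in> {1..nv M} \<Longrightarrow> p j \<in> Qpoly l"
    and fp: "\<And>j x v. j \<in> {1..nv M} \<Longrightarrow> x \<in> interior (cellx M i) \<Longrightarrow> v \<in> interior (cellv M j) \<Longrightarrow>
      f x v = p j x v"
    by metis
  define r where "r j x = integral (cellv M j) (p j x)" for j x
  define R where "R x = (\<Sum>j=1..nv M. r j x)" for x
  have r_cont: "continuous_on UNIV (r j)" if "j \<in> {1..nv M}" for j
  proof -
    have "continuous_on (UNIV \<times> cbox (vh M (j - 1)) (vh M j)) (\<lambda>(x, v). p j x v)"
      by (rule continuous_on_Qpoly[OF p[OF that]])
    then show ?thesis
      unfolding r_def cellv_def using integral_continuous_on_param by fastforce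
  qed
  have p_int: "((p j x) has_integral r j x) (cellv M j)" if "j \<in> {1..nv M}" for j x
  proof -
    have "continuous_on (cellv M j) ((\<lambda>(x, v). p j x v) \<circ> Pair x)"
      by (intro continuous_on_compose continuous_on_Qpoly[OF p[OF that]] continuous_intros)
    then show ?thesis
      unfolding r_def cellv_def
      by (intro integrable_integral integrable_continuous_real) (simp add: o_def)
  qed
  have rho: "charge_density M f x = R x" if x: "x \<in> interior (cellx M i)" for x
  proof -
    have "((f x) has_integral (\<Sum>j=1..nv M. r j x)) {vh M 0..vh M (nv M)}"
    proof (intro conjunct1[OF has_integral_mesh_sum])
      fix j assume j: "j \<in> {1..nv M}"
      show "vh M (j - 1) \<le> vh M j"
        using mesh j by (auto simp: valid_mesh_def intro: less_imp_le)
      show "(f x has_integral r j x) {vh M (j - 1)..vh M j}"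
        using p_int[OF j, of x] fp[OF j x] has_integral_spike_interior_interval
        unfolding cellv_def by blast
    qed
    then show ?thesis
      using mesh unfolding charge_density_def R_def valid_mesh_def by (auto intro: integral_unique)
  qed
  show "((\<lambda>x. E x * charge_density M f x) has_integral
      (\<Sum>j=1..nv M. integral (cell M i j) (\<lambda>(x, v). E x * f x v))) (cellx M i)"
    if E: "continuous_on (cellx M i) E" for E
  proof -
    have "((\<lambda>x. E x * r j x) has_integral integral (cell M i j) (\<lambda>(x, v). E x * f x v)) (cellx M i)"
      if j: "j \<in> {1..nv M}" for j
    proof -
      have "continuous_on (cell M i j) (\<lambda>z. E (fst z) * (case z of (x, v) \<Rightarrow> p j x v))"
        by (intro continuous_intros continuous_on_Qpoly[OF p[OF j]] continuous_on_compose2[OF E])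
          (auto simp: cell_def)
      then have cont: "continuous_on (cbox (xh M (i - 1), vh M (j - 1)) (xh M i, vh M j))
          (\<lambda>(x, v). E x * p j x v)"
        by (simp add: cell_def cellx_def cellv_def cbox_Pair_eq split_beta)
      have "integral (cell M i j) (\<lambda>(x, v). E x * f x v) = integral (cell M i j) (\<lambda>(x, v). E x * p j x v)"
        by (rule integral_spike_cell) (simp add: fp[OF j])
      also have "\<dots> = integral (cellx M i) (\<lambda>x. integral (cellv M j) (\<lambda>v. E x * p j x v))"
        using integral_prod_continuous[OF cont]
        by (simp add: cell_def cellx_def cellv_def cbox_Pair_eq o_def)
      also have "\<dots> = integral (cellx M i) (\<lambda>x. E x * r j x)"
        by (simp add: r_def)
      finally have eq: "integral (cell M i j) (\<lambda>(x, v). E x * f x v) = integral (cellx M i) (\<lambda>x. E x * r j x)" .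
      have "continuous_on (cellx M i) (\<lambda>x. E x * r j x)"
        by (intro continuous_intros E continuous_on_subset[OF r_cont[OF j]]) auto
      then show ?thesis
        unfolding eq cellx_def by (intro integrable_integral integrable_continuous_real)
    qed
    then have "((\<lambda>x. \<Sum>j=1..nv M. E x * r j x) has_integral
        (\<Sum>j=1..nv M. integral (cell M i j) (\<lambda>(x, v). E x * f x v))) (cellx M i)"
      by (intro has_integral_sum) auto
    then show ?thesis
      unfolding cellx_def
      by (rule has_integral_spike_interior_interval)
        (use rho in \<open>auto simp: R_def sum_distrib_left cellx_def\<close>)
  qed
  have "continuous_on (interior (cellx M i)) R"
    unfolding R_def by (intro continuous_on_sum continuous_on_subset[OF r_cont]) auto
  then show "continuous_on (interior (cellx M i)) (charge_density M f)"
    using rho by (simp cong: continuous_on_cong)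
qed

lemma mesh_cellx:
  assumes "valid_mesh M" "x \<in> {0..plen M}" "x \<notin> xh M ` {0..nx M}"
  obtains i where "i \<in> {1..nx M}" "x \<in> interior (cellx M i)"
proof -
  define i where "i = (LEAST i. x < xh M i)"
  have ex: "x < xh M (nx M)"
  proof -
    have "xh M (nx M) = plen M" "nx M \<in> {0..nx M}"
      using assms(1) by (auto simp: valid_mesh_def)
    then have "x \<noteq> plen M"
      using assms(3) by (metis image_eqI)
    then show ?thesis
      using assms(2) \<open>xh M (nx M) = plen M\<close> by simp
  qed
  have i: "x < xh M i" "i \<le> nx M"
    unfolding i_def using ex by (auto intro: LeastI Least_le)
  have "i \<noteq> 0" using i assms by (cases "i = 0") (auto simp: valid_mesh_def)
  moreover have "\<not> x < xh M (i - 1)"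
    using not_less_Least[of "i - 1" "\<lambda>i. x < xh M i"] \<open>i \<noteq> 0\<close> by (simp add: i_def)
  moreover have "x \<noteq> xh M (i - 1)"
    using assms(3) i(2) by auto
  ultimately show ?thesis
    using i by (intro that[of i]) (auto simp: cellx_def)
qed

lemma cellx_subset:
  assumes "valid_mesh M" "i \<in> {1..nx M}"
  shows "cellx M i \<subseteq> {0..plen M}"
proof -
  have mono: "xh M a \<le> xh M b" if "a \<le> b" "b \<le> nx M" for a b
    using that
  proof (induction rule: dec_induct)
    case base
    then show ?case by simp
  next
    case (step n)
    moreover have "xh M n < xh M (Suc n)"
      using assms(1) step by (auto simp: valid_mesh_def dest!: bspec[of _ _ "Suc n"])
    ultimately show ?case by simp
  qed
  show ?thesis
    using mono[of 0 "i - 1"] mono[of i "nx M"] assms by (auto simp: cellx_def valid_mesh_def)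
qed

text \<open>The weight \<open>E\<close> serves two purposes: \<open>E = 1\<close> expresses the total charge by cell integrals,
  and the electric field expresses the volume term left by the test function \<open>v\<close> as a
  one-dimensional integral.\<close>

theorem charge_density_has_integral:
  assumes mesh: "valid_mesh M" and f: "f \<in> Vh M l" and E: "continuous_on {0..plen M} E"
  shows "((\<lambda>x. E x * charge_density M f x) has_integral
      (\<Sum>i=1..nx M. \<Sum>j=1..nv M. integral (cell M i j) (\<lambda>(x, v). E x * f x v))) {0..plen M}"
proof -
  have "((\<lambda>x. E x * charge_density M f x) has_integral
      (\<Sum>i=1..nx M. \<Sum>j=1..nv M. integral (cell M i j) (\<lambda>(x, v). E x * f x v))) {xh M 0..xh M (nx M)}"
  proof (intro conjunct1[OF has_integral_mesh_sum])
    fix i assume i: "i \<in> {1..nx M}"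
    show "xh M (i - 1) \<le> xh M i"
      using mesh i by (auto simp: valid_mesh_def intro: less_imp_le)
    have "continuous_on (cellx M i) E"
      using E cellx_subset[OF mesh i] by (rule continuous_on_subset)
    then have "((\<lambda>x. E x * charge_density M f x) has_integral
        (\<Sum>j=1..nv M. integral (cell M i j) (\<lambda>(x, v). E x * f x v))) (cellx M i)"
      by (rule charge_density_strip_integral[OF mesh f i])
    then show "((\<lambda>x. E x * charge_density M f x) has_integral
        (\<Sum>j=1..nv M. integral (cell M i j) (\<lambda>(x, v). E x * f x v))) {xh M (i - 1)..xh M i}"
      unfolding cellx_def .
  qed
  then show ?thesis
    using mesh by (simp add: valid_mesh_def)
qed

definition mesh_inner :: "mesh \<Rightarrow> (real \<Rightarrow> real \<Rightarrow> real) \<Rightarrow> (real \<Rightarrow> real \<Rightarrow> real) \<Rightarrow> real" where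
  "mesh_inner M f \<phi> = (\<Sum>i=1..nx M. \<Sum>j=1..nv M. cell_inner M i j f \<phi>)"

lemma charge_neutral_iff:
  assumes "valid_mesh M" "f \<in> Vh M l"
  shows "charge_neutral M f \<longleftrightarrow> mesh_inner M f (\<lambda>x v. 1) = plen M"
  using charge_density_has_integral[OF assms, of "\<lambda>x. 1"]
  by (auto simp: charge_neutral_def mesh_inner_def cell_inner_def dest: integral_unique)

section \<open>The self-consistent field exerts no net force\<close>

lemma plen_pos: "valid_mesh M \<Longrightarrow> 0 < plen M"
proof -
  assume mesh: "valid_mesh M"
  then have one: "1 \<in> {1..nx M}" and "xh M 0 = 0"
    by (simp_all add: valid_mesh_def)
  with mesh have "0 < xh M 1"
    unfolding valid_mesh_def by (metis diff_self_eq_0)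
  moreover have "xh M 1 \<le> plen M"
    using cellx_subset[OF mesh one] \<open>0 < xh M 1\<close> \<open>xh M 0 = 0\<close> by (auto simp: cellx_def)
  ultimately show ?thesis by simp
qed

text \<open>The identity \<open>E \<rho> = E - (E\<^sup>2 / 2)'\<close> holds off the finitely many mesh nodes, where \<open>\<rho>\<close> may
  jump while \<open>E\<close> remains continuous; this is enough for the fundamental theorem of calculus.\<close>

theorem efield_force_zero:
  assumes mesh: "valid_mesh M" and f: "f \<in> Vh M l" and neutral: "charge_neutral M f"
  shows "(\<Sum>i=1..nx M. \<Sum>j=1..nv M. integral (cell M i j) (\<lambda>(x, v). efield M f x * f x v)) = 0"
proof -
  define L where "L = plen M"
  define \<rho> where "\<rho> = charge_density M f"
  define E where "E = efield M f"
  define Q where "Q s = integral {0..s} \<rho>" for s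
  have L: "0 < L" using plen_pos[OF mesh] by (simp add: L_def)
  have E_eq: "E x = efield_const M f + x - Q x" for x
    by (simp add: E_def efield_def Q_def \<rho>_def)
  have \<rho>_int: "\<rho> integrable_on {0..L}"
    using charge_density_has_integral[OF mesh f, of "\<lambda>x. 1"] by (auto simp: \<rho>_def L_def)
  have Q_cont: "continuous_on {0..L} Q"
    unfolding Q_def by (rule indefinite_integral_continuous_1[OF \<rho>_int])
  have E_cont: "continuous_on {0..L} E"
    unfolding E_eq[abs_def] by (intro continuous_intros Q_cont)
  have force: "((\<lambda>x. E x * \<rho> x) has_integral
      (\<Sum>i=1..nx M. \<Sum>j=1..nv M. integral (cell M i j) (\<lambda>(x, v). E x * f x v))) {0..L}"
    using charge_density_has_integral[OF mesh f] E_cont by (simp add: \<rho>_def L_def)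

  have E_deriv: "(E has_real_derivative 1 - \<rho> x) (at x)"
    if x: "x \<in> {0<..<L} - xh M ` {0..nx M}" for x
  proof -
    obtain i where i: "i \<in> {1..nx M}" and xi: "x \<in> interior (cellx M i)"
      using mesh_cellx[OF mesh, of x] x by (auto simp: L_def)
    have "continuous_on (interior (cellx M i)) \<rho>"
      unfolding \<rho>_def by (rule continuous_on_charge_density[OF mesh f i])
    then have "isCont \<rho> x"
      using xi by (simp add: continuous_on_eq_continuous_at)
    then have "(Q has_vector_derivative \<rho> x) (at x within {0..L})"
      unfolding Q_def using integral_has_vector_derivative_continuous_at[OF \<rho>_int, of x "{}"] x
      by (auto simp: continuous_at_imp_continuous_at_within)
    then have "(Q has_real_derivative \<rho> x) (at x)"
      using x at_within_interior[of x "{0..L}"] by (simp add: has_real_derivative_iff_has_vector_derivative)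
    then show ?thesis
      unfolding E_eq[abs_def] by (auto intro!: derivative_eq_intros)
  qed
  have "((\<lambda>x. E x * (1 - \<rho> x)) has_integral (E L)\<^sup>2 / 2 - (E 0)\<^sup>2 / 2) {0..L}"
  proof (rule fundamental_theorem_of_calculus_interior_strong[of "xh M ` {0..nx M}"])
    show "continuous_on {0..L} (\<lambda>x. (E x)\<^sup>2 / 2)"
      by (intro continuous_intros E_cont) auto
    show "((\<lambda>x. (E x)\<^sup>2 / 2) has_vector_derivative E x * (1 - \<rho> x)) (at x)"
      if "x \<in> {0<..<L} - xh M ` {0..nx M}" for x
      unfolding has_real_derivative_iff_has_vector_derivative[symmetric]
      by (rule derivative_eq_intros E_deriv[OF that] | simp)+
  qed (use L in auto)
  moreover have "E L = E 0"
    using neutral by (simp add: E_eq Q_def L_def \<rho>_def charge_neutral_def)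
  ultimately have EE': "((\<lambda>x. E x * (1 - \<rho> x)) has_integral 0) {0..L}"
    by simp

  \<comment> \<open>The field has zero mean: this is the condition that determines \<open>efield_const\<close>.\<close>
  have "((\<lambda>x. efield_const M f + x - Q x) has_integral
      (efield_const M f * L + (L\<^sup>2 - 0\<^sup>2) / 2 - integral {0..L} Q)) {0..L}"
    using L has_integral_const_real[of "efield_const M f" 0 L]
    by (intro has_integral_diff has_integral_add ident_has_integral integrable_integral
        integrable_continuous_real Q_cont) (auto simp: mult.commute)
  moreover have "efield_const M f * L + (L\<^sup>2 - 0\<^sup>2) / 2 - integral {0..L} Q = 0"
  proof -
    have "efield_const M f = - L / 2 + 1 / L * integral {0..L} Q"
      by (simp add: efield_const_def L_def Q_def[abs_def] \<rho>_def)
    then show ?thesis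
      using L by (simp add: left_diff_distrib power2_eq_square)
  qed
  ultimately have "(E has_integral 0) {0..L}"
    by (simp add: E_eq[abs_def])
  from has_integral_diff[OF this EE'] have "((\<lambda>x. E x * \<rho> x) has_integral 0) {0..L}"
    by (simp add: right_diff_distrib)
  with force show ?thesis
    unfolding E_def by (rule has_integral_unique)
qed

lemma sum_Hnonlin_one:
  assumes "valid_mesh M" "f \<in> Vh M l" "zero_at_cutoff M f"
  shows "(\<Sum>i=1..nx M. \<Sum>j=1..nv M. Hnonlin M i j f E (\<lambda>x v. 1)) = 0"
  using sum_Hnonlin_velocity_test[of M f "\<lambda>v. 1" "\<lambda>v. 0" E] assms
  by (simp add: Vh_def piecewise_space_def case_prod_unfold)

lemma sum_Hnonlin_velocity:
  assumes "valid_mesh M" "f \<in> Vh M l" "zero_at_cutoff M f" "charge_neutral M f"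
  shows "(\<Sum>i=1..nx M. \<Sum>j=1..nv M. Hnonlin M i j f (efield M f) (\<lambda>x v. v)) = 0"
  using sum_Hnonlin_velocity_test[of M f "\<lambda>v. v" "\<lambda>v. 1" "efield M f"] efield_force_zero[of M f l] assms
  by (simp add: Vh_def piecewise_space_def)

section \<open>Interpolation on a cell and differentiation in time\<close>

definition lagrange_basis :: "real set \<Rightarrow> real \<Rightarrow> real \<Rightarrow> real" where
  "lagrange_basis X k x = (\<Prod>y\<in>X - {k}. (x - y) / (k - y))"

text \<open>Both sides are polynomials of degree below the number of nodes, and they agree at the
  nodes.\<close>

lemma lagrange_interpolation:
  assumes "finite X" "l < card X"
  shows "(\<Sum>b\<le>l. c b * x ^ b) = (\<Sum>k\<in>X. (\<Sum>b\<le>l. c b * k ^ b) * lagrange_basis X k x)"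
proof -
  define P where "P = (\<Sum>b\<le>l. monom (c b) b)"
  define B where "B k = (\<Prod>y\<in>X - {k}. smult (1 / (k - y)) [:- y, 1:])" for k
  define Q where "Q = (\<Sum>k\<in>X. smult (poly P k) (B k))"
  have P: "poly P x = (\<Sum>b\<le>l. c b * x ^ b)" for x
    by (simp add: P_def poly_sum poly_monom)
  have B: "poly (B k) x = lagrange_basis X k x" for k x
    by (simp add: B_def lagrange_basis_def poly_prod diff_divide_distrib)
  have "degree P \<le> l"
    unfolding P_def by (intro degree_sum_le) (auto intro: order_trans[OF degree_monom_le])
  then have deg_P: "degree P < card X"
    using assms by simp
  have "degree (B k) < card X" if "k \<in> X" for k
  proof -
    have "degree (B k) \<le> sum (degree \<circ> (\<lambda>y. smult (1 / (k - y)) [:- y, 1:])) (X - {k})"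
      unfolding B_def using assms(1) by (intro degree_prod_sum_le) simp
    also have "\<dots> \<le> (\<Sum>y\<in>X - {k}. 1)"
      by (intro sum_mono) simp
    also have "\<dots> < card X"
      using that assms(1) by (metis card_Diff1_less card_eq_sum)
    finally show ?thesis .
  qed
  then have deg_Q: "degree Q < card X"
    unfolding Q_def using assms
    by (intro degree_sum_less) (auto intro: le_less_trans[OF degree_smult_le])
  have node: "lagrange_basis X k z = (if k = z then 1 else 0)" if "k \<in> X" "z \<in> X" for k z
    using that assms(1) by (auto simp: lagrange_basis_def intro!: prod_zero prod.neutral)
  have "poly Q z = poly P z" if "z \<in> X" for z
  proof -
    have "poly Q z = (\<Sum>k\<in>X. if k = z then poly P k else 0)"
      unfolding Q_def poly_sum by (intro sum.cong refl) (simp add: B node that)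
    then show ?thesis
      using that assms(1) by simp
  qed
  then have "\<And>z. z \<in> X \<Longrightarrow> poly P z = poly Q z"
    by simp
  then have "P = Q"
    using deg_P deg_Q by (rule poly_eqI_degree)
  then have "poly P x = poly Q x" by simp
  then show ?thesis
    by (simp add: Q_def poly_sum B P)
qed

text \<open>A member of the tensor product space is interpolated first in \<open>x\<close>, with coefficients
  depending on \<open>v\<close>, and then each of these in \<open>v\<close>.\<close>

lemma Qpoly_interpolation:
  assumes p: "p \<in> Qpoly l" and X: "finite X" "l < card X" and Y: "finite Y" "l < card Y"
  shows "p x v = (\<Sum>k\<in>X. \<Sum>m\<in>Y. p k m * (lagrange_basis X k x * lagrange_basis Y m v))"
proof -
  obtain c where c: "\<And>x v. p x v = (\<Sum>a\<le>l. \<Sum>b\<le>l. c a b * x ^ a * v ^ b)"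
    using p unfolding Qpoly_def by blast
  have in_x: "p x v = (\<Sum>a\<le>l. (\<Sum>b\<le>l. c a b * v ^ b) * x ^ a)" for x v
    unfolding c sum_distrib_right by (intro sum.cong refl) simp
  have in_v: "p x v = (\<Sum>b\<le>l. (\<Sum>a\<le>l. c a b * x ^ a) * v ^ b)" for x v
    unfolding c sum_distrib_right by (subst sum.swap) simp
  have "p x v = (\<Sum>k\<in>X. p k v * lagrange_basis X k x)"
    unfolding in_x by (rule lagrange_interpolation[OF X])
  moreover have "p k v = (\<Sum>m\<in>Y. p k m * lagrange_basis Y m v)" for k
    unfolding in_v by (rule lagrange_interpolation[OF Y])
  ultimately show ?thesis
    by (simp add: sum_distrib_left mult_ac)
qed

text \<open>Differentiation under the integral sign, where finite dimension replaces a dominating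
  function: with interpolation nodes inside the cell, the expansion of \<open>f s\<close> has point values of \<open>f s\<close> as
  coefficients. These are differentiable by hypothesis, so the time derivative \<open>D\<close> has the same
  expansion with the values of \<open>D\<close>, and both integrals are given by the same quadrature
  weights \<open>W\<close>.\<close>

theorem cell_inner_has_time_derivative:
  assumes mesh: "valid_mesh M" and i: "i \<in> {1..nx M}" and j: "j \<in> {1..nv M}"
    and \<phi>: "continuous_on (cell M i j) (\<lambda>(x, v). \<phi> x v)"
    and t: "t \<in> {0..T}" "0 < T"
    and f: "\<And>s. s \<in> {0..T} \<Longrightarrow> f s \<in> Vh M l"
    and diff: "\<And>x v. x \<in> interior (cellx M i) \<Longrightarrow> v \<in> interior (cellv M j) \<Longrightarrow>
      (\<lambda>s. f s x v) differentiable (at t within {0..T})"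
  shows "((\<lambda>s. cell_inner M i j (f s) \<phi>) has_real_derivative
      cell_inner M i j (\<lambda>x v. vector_derivative (\<lambda>s. f s x v) (at t within {0..T})) \<phi>)
    (at t within {0..T})"
proof -
  have "infinite (interior (cellx M i))" "infinite (interior (cellv M j))"
    using mesh i j by (auto simp: cellx_def cellv_def valid_mesh_def)
  then obtain X Y where X: "finite X" "card X = Suc l" "X \<subseteq> interior (cellx M i)"
    and Y: "finite Y" "card Y = Suc l" "Y \<subseteq> interior (cellv M j)"
    by (metis infinite_arbitrarily_large)
  define L where "L k m x v = lagrange_basis X k x * lagrange_basis Y m v" for k m x v
  define W where "W k m = integral (cell M i j) (\<lambda>(x, v). L k m x v * \<phi> x v)" for k m
  define D where "D x v = vector_derivative (\<lambda>s. f s x v) (at t within {0..T})" for x v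

  have L_int: "((\<lambda>(x, v). L k m x v * \<phi> x v) has_integral W k m) (cell M i j)" for k m
  proof -
    have "continuous_on (cell M i j) (\<lambda>z. L k m (fst z) (snd z) * (case z of (x, v) \<Rightarrow> \<phi> x v))"
      unfolding L_def lagrange_basis_def
      by (intro continuous_intros \<phi>) (use X Y in auto)
    then have "(\<lambda>(x, v). L k m x v * \<phi> x v) integrable_on
        cbox (xh M (i - 1), vh M (j - 1)) (xh M i, vh M j)"
      by (intro integrable_continuous) (simp add: cell_def cellx_def cellv_def cbox_Pair_eq split_beta)
    then show ?thesis
      unfolding W_def by (intro integrable_integral) (simp add: cell_def cellx_def cellv_def cbox_Pair_eq)
  qed
  have inner: "cell_inner M i j g \<phi> = (\<Sum>k\<in>X. \<Sum>m\<in>Y. g k m * W k m)"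
    if g: "\<And>x v. x \<in> interior (cellx M i) \<Longrightarrow> v \<in> interior (cellv M j) \<Longrightarrow>
      g x v = (\<Sum>k\<in>X. \<Sum>m\<in>Y. g k m * L k m x v)" for g
  proof -
    have "cell_inner M i j g \<phi> = integral (cell M i j)
        (\<lambda>z. \<Sum>k\<in>X. \<Sum>m\<in>Y. g k m * (case z of (x, v) \<Rightarrow> L k m x v * \<phi> x v))"
      unfolding cell_inner_def
    proof (rule integral_spike_cell)
      fix x v assume "x \<in> interior (cellx M i)" "v \<in> interior (cellv M j)"
      from g[OF this] have "g x v * \<phi> x v = (\<Sum>k\<in>X. \<Sum>m\<in>Y. g k m * L k m x v) * \<phi> x v"
        by simp
      then show "(case (x, v) of (x, v) \<Rightarrow> g x v * \<phi> x v) =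
          (\<Sum>k\<in>X. \<Sum>m\<in>Y. g k m * (case (x, v) of (x, v) \<Rightarrow> L k m x v * \<phi> x v))"
        by (simp add: sum_distrib_right mult.assoc)
    qed
    also have "\<dots> = (\<Sum>k\<in>X. \<Sum>m\<in>Y. g k m * W k m)"
      by (intro integral_unique has_integral_sum has_integral_mult_right L_int X Y)
    finally show ?thesis .
  qed

  have f_expand: "f s x v = (\<Sum>k\<in>X. \<Sum>m\<in>Y. f s k m * L k m x v)"
    if s: "s \<in> {0..T}" and x: "x \<in> interior (cellx M i)" and v: "v \<in> interior (cellv M j)" for s x v
  proof -
    obtain p where p: "p \<in> Qpoly l"
      "\<And>x v. x \<in> interior (cellx M i) \<Longrightarrow> v \<in> interior (cellv M j) \<Longrightarrow> f s x v = p x v"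
      using Vh_cell_poly[OF f[OF s] i j] by metis
    have "f s x v = (\<Sum>k\<in>X. \<Sum>m\<in>Y. p k m * L k m x v)"
      unfolding p(2)[OF x v] L_def using X Y by (intro Qpoly_interpolation[OF p(1)]) auto
    also have "\<dots> = (\<Sum>k\<in>X. \<Sum>m\<in>Y. f s k m * L k m x v)"
      using X(3) Y(3) by (intro sum.cong refl) (simp add: p(2) subset_iff)
    finally show ?thesis .
  qed
  have f_deriv: "((\<lambda>s. f s x v) has_real_derivative D x v) (at t within {0..T})"
    if "x \<in> interior (cellx M i)" "v \<in> interior (cellv M j)" for x v
    using diff[OF that] unfolding D_def has_real_derivative_iff_has_vector_derivative
    by (simp add: vector_derivative_works)
  have node_deriv: "((\<lambda>s. f s k m) has_real_derivative D k m) (at t within {0..T})"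
    if "k \<in> X" "m \<in> Y" for k m
    using that X(3) Y(3) by (intro f_deriv) auto
  have sum_deriv: "((\<lambda>s. \<Sum>k\<in>X. \<Sum>m\<in>Y. f s k m * w k m) has_real_derivative
      (\<Sum>k\<in>X. \<Sum>m\<in>Y. D k m * w k m)) (at t within {0..T})" for w
    by (intro DERIV_sum DERIV_cmult_right node_deriv)
  have D_expand: "D x v = (\<Sum>k\<in>X. \<Sum>m\<in>Y. D k m * L k m x v)"
    if x: "x \<in> interior (cellx M i)" and v: "v \<in> interior (cellv M j)" for x v
  proof -
    have "((\<lambda>s. f s x v) has_real_derivative (\<Sum>k\<in>X. \<Sum>m\<in>Y. D k m * L k m x v)) (at t within {0..T})"
      by (rule has_field_derivative_transform_within[OF sum_deriv, of 1])
        (use t f_expand[OF _ x v] in auto)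
    then show ?thesis
      unfolding D_def has_real_derivative_iff_has_vector_derivative
      using vector_derivative_within_cbox[of 0 T t] t by simp
  qed

  have "cell_inner M i j D \<phi> = (\<Sum>k\<in>X. \<Sum>m\<in>Y. D k m * W k m)"
    by (rule inner) (rule D_expand)
  moreover have "cell_inner M i j (f s) \<phi> = (\<Sum>k\<in>X. \<Sum>m\<in>Y. f s k m * W k m)" if "s \<in> {0..T}" for s
    by (rule inner) (rule f_expand[OF that])
  then have "((\<lambda>s. cell_inner M i j (f s) \<phi>) has_real_derivative
      (\<Sum>k\<in>X. \<Sum>m\<in>Y. D k m * W k m)) (at t within {0..T})"
    by (intro has_field_derivative_transform_within[OF sum_deriv, of 1]) (use t in auto)
  ultimately have "((\<lambda>s. cell_inner M i j (f s) \<phi>) has_real_derivative cell_inner M i j D \<phi>)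
      (at t within {0..T})"
    by simp
  then show ?thesis
    by (simp add: D_def[abs_def])
qed

section \<open>Conservation of charge and momentum\<close>

text \<open>Since \<open>Wh M l \<subseteq> Vh M l\<close>, it suffices to find the test functions in the smaller space; both
  discrete spaces then lie between \<open>Wh M l\<close> and \<open>Vh M l\<close>.\<close>

lemma one_in_Wh: "(\<lambda>x v. 1) \<in> Wh M l"
proof -
  have "(1::real) = (\<Sum>a\<le>l. \<Sum>b\<le>l - a. (if a = 0 \<and> b = 0 then 1 else 0) * x ^ a * v ^ b)" for x v :: real
    by (subst sum.mono_neutral_right[of _ "{0}"]) (auto simp: if_distrib if_distribR sum.delta cong: if_cong)
  then have "(\<lambda>x v. 1) \<in> Ppoly l"
    unfolding Ppoly_def by (auto intro!: exI[of _ "\<lambda>a b. if a = 0 \<and> b = 0 then 1 else 0"])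
  then show ?thesis
    unfolding Wh_def piecewise_space_def by auto
qed

lemma velocity_in_Wh:
  assumes "1 \<le> l"
  shows "(\<lambda>x v. v) \<in> Wh M l"
proof -
  have "v = (\<Sum>a\<le>l. \<Sum>b\<le>l - a. (if a = 0 \<and> b = 1 then 1 else 0) * x ^ a * v ^ b)" for x v :: real
    using assms
    by (subst sum.mono_neutral_right[of _ "{0}"]) (auto simp: if_distrib if_distribR sum.delta cong: if_cong)
  then have "(\<lambda>x v. v) \<in> Ppoly l"
    unfolding Ppoly_def by (auto intro!: exI[of _ "\<lambda>a b. if a = 0 \<and> b = 1 then 1 else 0"])
  then show ?thesis
    unfolding Wh_def piecewise_space_def by auto
qed

text \<open>By the scheme with test function \<open>1\<close>, the time derivative of the total charge is a sum of
  fluxes that cancel.\<close>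

lemma semidiscrete_charge_neutral:
  assumes mesh: "valid_mesh M" and S: "Wh M l \<subseteq> S" "S \<subseteq> Vh M l" and "0 < T"
    and sol: "semidiscrete_solution M S T f"
    and neutral: "charge_neutral M (f 0)"
    and zero: "\<And>t. t \<in> {0..T} \<Longrightarrow> zero_at_cutoff M (f t)"
    and t: "t \<in> {0..T}"
  shows "charge_neutral M (f t)"
proof -
  have f: "f t \<in> Vh M l" if "t \<in> {0..T}" for t
    using sol S(2) that unfolding semidiscrete_solution_def by blast
  have one: "(\<lambda>x v. 1) \<in> S"
    using one_in_Wh S(1) by blast
  have "((\<lambda>t. mesh_inner M (f t) (\<lambda>x v. 1)) has_real_derivative 0) (at t within {0..T})"
    if t: "t \<in> {0..T}" for t
  proof -
    have "((\<lambda>s. cell_inner M i j (f s) (\<lambda>x v. 1)) has_real_derivative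
        Hnonlin M i j (f t) (efield M (f t)) (\<lambda>x v. 1)) (at t within {0..T})"
      if i: "i \<in> {1..nx M}" and j: "j \<in> {1..nv M}" for i j
    proof -
      have "cell_inner M i j (\<lambda>x v. vector_derivative (\<lambda>s. f s x v) (at t within {0..T})) (\<lambda>x v. 1) =
          Hnonlin M i j (f t) (efield M (f t)) (\<lambda>x v. 1)"
        using sol one t i j unfolding semidiscrete_solution_def by blast
      moreover have "(\<lambda>s. f s x v) differentiable (at t within {0..T})"
        if "x \<in> interior (cellx M i)" "v \<in> interior (cellv M j)" for x v
        using sol t i j that unfolding semidiscrete_solution_def by blast
      ultimately show ?thesis
        using cell_inner_has_time_derivative[OF mesh i j, of "\<lambda>x v. 1" t T f l] t f \<open>0 < T\<close>
        by (simp add: case_prod_unfold)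
    qed
    then have "((\<lambda>t. mesh_inner M (f t) (\<lambda>x v. 1)) has_real_derivative
        (\<Sum>i=1..nx M. \<Sum>j=1..nv M. Hnonlin M i j (f t) (efield M (f t)) (\<lambda>x v. 1))) (at t within {0..T})"
      unfolding mesh_inner_def by (intro DERIV_sum)
    then show ?thesis
      using sum_Hnonlin_one[OF mesh f[OF t] zero[OF t]] by simp
  qed
  then obtain c where c: "\<forall>t\<in>{0..T}. mesh_inner M (f t) (\<lambda>x v. 1) = c"
    using has_field_derivative_zero_constant[OF convex_real_interval(5)] by blast
  have 0: "0 \<in> {0..T}" using \<open>0 < T\<close> by simp
  show ?thesis
    using neutral c t 0 charge_neutral_iff[OF mesh f[OF t]] charge_neutral_iff[OF mesh f[OF 0]] by simp
qed

text \<open>The weights of the old values in each stage add up to one, so a linear functional whose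
  increments vanish keeps its value through all stages.\<close>

lemma rk3_step_conserves:
  assumes step: "rk3_step M S dt f f1 f2 g" and \<phi>: "\<phi> \<in> S"
    and H: "\<And>h. h \<in> {f, f1, f2} \<Longrightarrow>
      (\<Sum>i=1..nx M. \<Sum>j=1..nv M. Hnonlin M i j h (efield M h) \<phi>) = 0"
  shows "mesh_inner M f1 \<phi> = mesh_inner M f \<phi>" "mesh_inner M f2 \<phi> = mesh_inner M f \<phi>"
    "mesh_inner M g \<phi> = mesh_inner M f \<phi>"
proof -
  define F where "F h = (\<Sum>i=1..nx M. \<Sum>j=1..nv M. Hnonlin M i j h (efield M h) \<phi>)" for h
  have F0: "F f = 0" "F f1 = 0" "F f2 = 0"
    using H unfolding F_def by auto
  note stages = step[unfolded rk3_step_def, THEN conjunct2, THEN conjunct2, THEN conjunct2,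
      THEN conjunct2, THEN bspec, OF \<phi>, rule_format]
  have "mesh_inner M f1 \<phi> = mesh_inner M f \<phi> + dt * F f"
    unfolding mesh_inner_def F_def sum_distrib_left sum.distrib[symmetric]
    using stages by (intro sum.cong refl) blast
  then show 1: "mesh_inner M f1 \<phi> = mesh_inner M f \<phi>"
    using F0 by simp
  have "mesh_inner M f2 \<phi> = 3 / 4 * mesh_inner M f \<phi> + 1 / 4 * mesh_inner M f1 \<phi> + dt / 4 * F f1"
    unfolding mesh_inner_def F_def sum_distrib_left sum.distrib[symmetric]
    using stages by (intro sum.cong refl) blast
  then show 2: "mesh_inner M f2 \<phi> = mesh_inner M f \<phi>"
    using F0 1 by simp
  have "mesh_inner M g \<phi> = 1 / 3 * mesh_inner M f \<phi> + 2 / 3 * mesh_inner M f2 \<phi> + 2 * dt / 3 * F f2"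
    unfolding mesh_inner_def F_def sum_distrib_left sum.distrib[symmetric]
    using stages by (intro sum.cong refl) blast
  then show "mesh_inner M g \<phi> = mesh_inner M f \<phi>"
    using F0 2 by simp
qed

text \<open>Charge increments vanish by \<open>sum_Hnonlin_one\<close>, so each stage inherits the total charge of \<open>f\<close>.
  Neutrality of the stages in turn yields the vanishing of their momentum increments.\<close>

lemma rk3_step_charge_neutral:
  assumes mesh: "valid_mesh M" and S: "Wh M l \<subseteq> S" "S \<subseteq> Vh M l"
    and step: "rk3_step M S dt f f1 f2 g"
    and zero: "\<And>h. h \<in> {f, f1, f2} \<Longrightarrow> zero_at_cutoff M h"
    and neutral: "charge_neutral M f" and h: "h \<in> {f1, f2, g}"
  shows "charge_neutral M h"
proof -
  have mem: "f \<in> Vh M l" "f1 \<in> Vh M l" "f2 \<in> Vh M l" "g \<in> Vh M l"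
    using step S(2) unfolding rk3_step_def by auto
  have "mesh_inner M h (\<lambda>x v. 1) = mesh_inner M f (\<lambda>x v. 1)"
    using rk3_step_conserves[OF step, of "\<lambda>x v. 1"] one_in_Wh S(1) h
      sum_Hnonlin_one[OF mesh _ zero] mem by blast
  then show ?thesis
    using neutral h mem charge_neutral_iff[OF mesh] by auto
qed

theorem proposition3:
  fixes M :: mesh and l :: nat and S :: "(real \<Rightarrow> real \<Rightarrow> real) set"
  assumes mesh: "valid_mesh M"
    and l: "1 \<le> l"
    and S: "S = Vh M l \<or> S = Wh M l"
  shows
    "(\<forall>(T::real) (f :: real \<Rightarrow> real \<Rightarrow> real \<Rightarrow> real).
        0 < T \<longrightarrow>
        semidiscrete_solution M S T f \<longrightarrow>
        charge_neutral M (f 0) \<longrightarrow>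
        (\<forall>t\<in>{0..T}. zero_at_cutoff M (f t)) \<longrightarrow>
        (\<forall>t\<in>{0..T}.
           (\<Sum>i=1..nx M. \<Sum>j=1..nv M. Hnonlin M i j (f t) (efield M (f t)) (\<lambda>x v. v)) = 0))
     \<and>
     (\<forall>(N::nat) (dt :: nat \<Rightarrow> real) (f :: nat \<Rightarrow> real \<Rightarrow> real \<Rightarrow> real)
        (f1 :: nat \<Rightarrow> real \<Rightarrow> real \<Rightarrow> real) (f2 :: nat \<Rightarrow> real \<Rightarrow> real \<Rightarrow> real).
        (\<forall>n<N. 0 < dt n) \<longrightarrow>
        (\<forall>n<N. rk3_step M S (dt n) (f n) (f1 n) (f2 n) (f (Suc n))) \<longrightarrow>
        charge_neutral M (f 0) \<longrightarrow>
        (\<forall>n<N. zero_at_cutoff M (f n) \<and> zero_at_cutoff M (f1 n) \<and> zero_at_cutoff M (f2 n)) \<longrightarrow>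
        (\<forall>n<N.
           (\<forall>g\<in>{f n, f1 n, f2 n}.
              (\<Sum>i=1..nx M. \<Sum>j=1..nv M. Hnonlin M i j g (efield M g) (\<lambda>x v. v)) = 0) \<and>
           (\<Sum>i=1..nx M. \<Sum>j=1..nv M. integral (cell M i j) (\<lambda>(x, v). f (Suc n) x v * v)) =
           (\<Sum>i=1..nx M. \<Sum>j=1..nv M. integral (cell M i j) (\<lambda>(x, v). f n x v * v))))"
proof -
  have sub: "Wh M l \<subseteq> S" "S \<subseteq> Vh M l"
    using S Wh_subset_Vh by auto
  have velocity: "(\<lambda>x v. v) \<in> S"
    using velocity_in_Wh[OF l] sub by blast
  have semi: "(\<Sum>i=1..nx M. \<Sum>j=1..nv M. Hnonlin M i j (f t) (efield M (f t)) (\<lambda>x v. v)) = 0"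
    if "0 < T" "semidiscrete_solution M S T f" "charge_neutral M (f 0)"
      "\<forall>t\<in>{0..T}. zero_at_cutoff M (f t)" "t \<in> {0..T}" for T f t
  proof (rule sum_Hnonlin_velocity[OF mesh])
    show "f t \<in> Vh M l"
      using that sub unfolding semidiscrete_solution_def by blast
    show "charge_neutral M (f t)"
      using semidiscrete_charge_neutral[OF mesh sub] that by blast
  qed (use that in blast)
  have full: "(\<forall>g\<in>{f n, f1 n, f2 n}.
        (\<Sum>i=1..nx M. \<Sum>j=1..nv M. Hnonlin M i j g (efield M g) (\<lambda>x v. v)) = 0) \<and>
      (\<Sum>i=1..nx M. \<Sum>j=1..nv M. integral (cell M i j) (\<lambda>(x, v). f (Suc n) x v * v)) =
      (\<Sum>i=1..nx M. \<Sum>j=1..nv M. integral (cell M i j) (\<lambda>(x, v). f n x v * v))"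
    if step: "\<forall>n<N. rk3_step M S (dt n) (f n) (f1 n) (f2 n) (f (Suc n))"
      and neutral: "charge_neutral M (f 0)"
      and zero: "\<forall>n<N. zero_at_cutoff M (f n) \<and> zero_at_cutoff M (f1 n) \<and> zero_at_cutoff M (f2 n)"
      and n: "n < N" for N n :: nat and dt f f1 f2
  proof -
    have stages_neutral: "charge_neutral M h"
      if "m < N" "charge_neutral M (f m)" "h \<in> {f1 m, f2 m, f (Suc m)}" for m h
      using rk3_step_charge_neutral[OF mesh sub, of "dt m" "f m" "f1 m" "f2 m" "f (Suc m)" h]
        step zero that by blast
    have "charge_neutral M (f m)" if "m \<le> N" for m
      using that by (induction m) (use neutral stages_neutral in \<open>auto simp: Suc_le_eq\<close>)
    then have n_neutral: "charge_neutral M (f n)"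
      using n by simp
    have momentum: "(\<Sum>i=1..nx M. \<Sum>j=1..nv M. Hnonlin M i j g (efield M g) (\<lambda>x v. v)) = 0"
      if g: "g \<in> {f n, f1 n, f2 n}" for g
    proof (rule sum_Hnonlin_velocity[OF mesh])
      show "g \<in> Vh M l"
        using g step n sub unfolding rk3_step_def by blast
      show "zero_at_cutoff M g"
        using g zero n by blast
      show "charge_neutral M g"
        using g n_neutral stages_neutral[OF n n_neutral] by blast
    qed
    then have "mesh_inner M (f (Suc n)) (\<lambda>x v. v) = mesh_inner M (f n) (\<lambda>x v. v)"
      using step n velocity by (intro rk3_step_conserves(3)) blast+
    then show ?thesis
      using momentum unfolding mesh_inner_def cell_inner_def by blast
  qed
  show ?thesis
    using semi full by blast
qed

end
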